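(* Let $C$ be an extreme point of $\operatorname{Cor}(m,n)$ and let $r=\operatorname{rank}(C)$. Every commuting operator representation of $C$ uses matrices of size at least $(2^{\lfloor r/2\rfloor})^2$; that is, if $C$ admits a commuting operator representation by $d\times d$ matrices, then $d\ge(2^{\lfloor r/2\rfloor})^2$.
   Context: $\operatorname{Cor}(m,n)$ denotes the (convex) set of all bipartite correlation matrices of size $m\times n$, i.e., matrices $C\in\mathbb{R}^{m\times n}$ for which there exist real unit vectors $x_1,\ldots,x_m,y_1,\ldots,y_n\in\mathbb{R}^{d'}$ (for some $d'\ge1$) with $C_{s,t}=\langle x_s,y_t\rangle$ for all $s\in\{1,\ldots,m\}$, $t\in\{1,\ldots,n\}$. A (finite dimensional) commuting operator representation of $C\in\mathbb{R}^{m\times n}$ by $d\times d$ matrices consists of a Hermitian positive semidefinite $d\times d$ matrix $W$ with $\mathrm{Tr}(W)=1$ and Hermitian $d\times d$ matrices $X_1,\ldots,X_m$ and $Y_1,\ldots,Y_n$ with spectra contained in $[-1,1]$, such that $X_sY_t=Y_tX_s$ and $C_{s,t}=\mathrm{Tr}(X_sY_tW)$ for all $s\in\{1,\ldots,m\}$ and $t\in\{1,\ldots,n\}$. *)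

theory Defs
  imports "HOL-Analysis.Analysis"
begin

text \<open>
  An \<open>m \<times> n\<close> matrix is an element of \<^typ>\<open>real^'n^'m\<close> (\<open>'m\<close> indexes the rows). In the set of
  bipartite correlation matrices the dimension \<open>d\<close> of the ambient Euclidean space is existentially
  quantified, so it cannot be a type; a vector in \<open>d\<close>-dimensional space is represented by its
  coordinates at the indices \<open>i < d\<close>.
\<close>

definition Cor :: "(real^'n^'m) set" where
  "Cor = {C. \<exists>d\<ge>1. \<exists>(x :: 'm \<Rightarrow> nat \<Rightarrow> real) (y :: 'n \<Rightarrow> nat \<Rightarrow> real).
     (\<forall>s. sqrt (\<Sum>i<d. (x s i)\<^sup>2) = 1) \<and>
     (\<forall>t. sqrt (\<Sum>i<d. (y t i)\<^sup>2) = 1) \<and>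
     (\<forall>s t. C $ s $ t = (\<Sum>i<d. x s i * y t i))}"

definition hermitian :: "complex^'d^'d \<Rightarrow> bool" where
  "hermitian A \<longleftrightarrow> (\<forall>i j. A $ i $ j = cnj (A $ j $ i))"

text \<open>The quadratic form of a Hermitian matrix is real-valued, so taking \<open>Re\<close> loses nothing.\<close>

definition hermitian_psd :: "complex^'d^'d \<Rightarrow> bool" where
  "hermitian_psd A \<longleftrightarrow>
     hermitian A \<and> (\<forall>v. 0 \<le> Re (\<Sum>i\<in>UNIV. cnj (v $ i) * (A *v v) $ i))"

definition spectrum :: "complex^'d^'d \<Rightarrow> complex set" where
  "spectrum A = {c. \<exists>v. v \<noteq> 0 \<and> A *v v = c *s v}"

definition commuting_operator_rep ::
  "real^'n^'m \<Rightarrow> complex^'d^'d \<Rightarrow> ('m \<Rightarrow> complex^'d^'d) \<Rightarrow> ('n \<Rightarrow> complex^'d^'d) \<Rightarrow> bool" where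
  "commuting_operator_rep C W X Y \<longleftrightarrow>
     hermitian_psd W \<and> trace W = 1 \<and>
     (\<forall>s. hermitian (X s) \<and> spectrum (X s) \<subseteq> complex_of_real ` {-1..1}) \<and>
     (\<forall>t. hermitian (Y t) \<and> spectrum (Y t) \<subseteq> complex_of_real ` {-1..1}) \<and>
     (\<forall>s t. X s ** Y t = Y t ** X s) \<and>
     (\<forall>s t. complex_of_real (C $ s $ t) = trace (X s ** Y t ** W))"

end

theory Submission
  imports Defs
begin

text \<open>
  Write \<open>r\<close> for the rank of \<open>C\<close>. All norms and inner products are the real ones on \<^typ>\<open>complex^'d\<close>,
  that is, real parts of the Hermitian ones; for them a Hermitian matrix is self-adjoint, and one
  with spectrum in \<open>[-1, 1]\<close> is a contraction.

  The state can be taken pure. A positive semidefinite \<open>W\<close> of trace one is a combination of rank-one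
  pieces, which displays \<open>C\<close> as a convex combination of correlation matrices
  \<open>\<langle>X\<^sub>s v, Y\<^sub>t v\<rangle>\<close> with unit vectors \<open>v\<close>. Since \<open>C\<close> is extreme it equals one of them
  (\<open>extreme_rep_pure_state\<close>).

  Extremality makes the vectors \<open>x\<^sub>s = X\<^sub>s v\<close>, \<open>y\<^sub>t = Y\<^sub>t v\<close> rigid, because any slack could be used to
  move \<open>C\<close> in two opposite directions: all of them are unit vectors (\<open>extreme_unit\<close>), the \<open>x\<^sub>s\<close> and the
  \<open>y\<^sub>t\<close> have the same real span \<open>H\<close> (\<open>extreme_span\<close>), of dimension at least \<open>r\<close>, and a symmetric
  bilinear form that vanishes on the diagonal at each \<open>x\<^sub>s\<close> and each \<open>y\<^sub>t\<close> vanishes on \<open>H\<close>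
  (\<open>extreme_form_zero\<close>).

  Rigidity produces Clifford relations (\<open>extreme_Clifford_lifts\<close>). For \<open>u \<in> H\<close> let \<open>g u\<close> be a real
  combination of the \<open>X\<^sub>s\<close>, and \<open>h u\<close> one of the \<open>Y\<^sub>t\<close>, with \<open>g u v = u = h u v\<close>. From
  \<open>g u g w v = g u h w v = h w g u v\<close> it follows that \<open>g u g w v\<close> depends only on the vectors \<open>u\<close>, \<open>w\<close>,
  not on the combinations chosen, so the symmetric form \<open>g u g w v + g w g u v - 2 \<langle>u, w\<rangle> v\<close> takes at
  \<open>u = w = x\<^sub>s\<close> the value \<open>2 X\<^sub>s\<^sup>2 v - 2 v = 0\<close>, and likewise at \<open>y\<^sub>t\<close>. Hence it vanishes
  on \<open>H\<close>, and the same holds for \<open>h\<close>.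

  These relations at \<open>v\<close> propagate to the set \<open>V\<close> of all vectors of both forms \<open>p v\<close> and \<open>q v\<close>, where
  \<open>p\<close> commutes with the \<open>X\<^sub>s\<close> and \<open>q\<close> with the \<open>Y\<^sub>t\<close>. It is a complex subspace that contains \<open>v\<close> and is
  invariant under all \<open>g u\<close> and \<open>h u\<close>. An orthonormal system of \<open>2 * (r div 2)\<close> vectors in \<open>H\<close>
  therefore gives two commuting Clifford families on \<open>V\<close>; each consecutive pair of generators gives an
  involution whose two eigenspaces are exchanged by another operator, and every such involution
  doubles the dimension (\<open>commuting_Clifford_families_dim\<close>). There are \<open>r div 2\<close> of them for \<open>g\<close> and
  as many for \<open>h\<close>.
\<close>

section \<open>Correlation matrices\<close>

text \<open>
  Vectors of norm at most one can be made unit vectors without changing the products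
  \<open>\<langle>x\<^sub>s, y\<^sub>t\<rangle>\<close> by two extra coordinates, one in which only the \<open>x\<^sub>s\<close> and one in which only the \<open>y\<^sub>t\<close> are
  nonzero. This freedom is what makes perturbation arguments possible.
\<close>

lemma Cor_memI_finite:
  fixes C :: "real^'n^'m" and x :: "'m \<Rightarrow> 'i \<Rightarrow> real" and y :: "'n \<Rightarrow> 'i \<Rightarrow> real"
  assumes fin: "finite I"
    and x: "\<And>s. (\<Sum>i\<in>I. (x s i)\<^sup>2) \<le> 1"
    and y: "\<And>t. (\<Sum>i\<in>I. (y t i)\<^sup>2) \<le> 1"
    and C: "\<And>s t. C $ s $ t = (\<Sum>i\<in>I. x s i * y t i)"
  shows "C \<in> Cor"
proof -
  obtain f where f: "bij_betw f {..<card I} I"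
    using fin bij_betw_from_nat_into_finite[of I] by blast
  define n where "n = card I"
  define x' where "x' s i = (if i < n then x s (f i)
    else if i = n then sqrt (1 - (\<Sum>i\<in>I. (x s i)\<^sup>2)) else 0)" for s i
  define y' where "y' t i = (if i < n then y t (f i)
    else if i = n then 0 else sqrt (1 - (\<Sum>i\<in>I. (y t i)\<^sup>2)))" for t i
  have re: "(\<Sum>i<n. F (f i)) = (\<Sum>i\<in>I. F i)" for F :: "'i \<Rightarrow> real"
    unfolding n_def by (rule sum.reindex_bij_betw[OF f])
  have "(\<Sum>i<n+2. (x' s i)\<^sup>2) = 1" for s
    using x[of s] re[of "\<lambda>i. (x s i)\<^sup>2"] by (simp add: x'_def)
  moreover have "(\<Sum>i<n+2. (y' t i)\<^sup>2) = 1" for t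
    using y[of t] re[of "\<lambda>i. (y t i)\<^sup>2"] by (simp add: y'_def)
  moreover have "C $ s $ t = (\<Sum>i<n+2. x' s i * y' t i)" for s t
    using C[of s t] re[of "\<lambda>i. x s i * y t i"] by (simp add: x'_def y'_def)
  ultimately show ?thesis
    unfolding Cor_def by (intro CollectI exI[of _ "n+2"] conjI exI[of _ x'] exI[of _ y']) simp_all
qed

lemma Cor_memI_inner:
  fixes C :: "real^'n^'m" and x :: "'m \<Rightarrow> 'a::euclidean_space" and y :: "'n \<Rightarrow> 'a"
  assumes "\<And>s. norm (x s) \<le> 1" "\<And>t. norm (y t) \<le> 1" "\<And>s t. C $ s $ t = x s \<bullet> y t"
  shows "C \<in> Cor"
proof (rule Cor_memI_finite[where I = "Basis :: 'a set" and x = "\<lambda>s b. x s \<bullet> b" and y = "\<lambda>t b. y t \<bullet> b"])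
  have *: "(\<Sum>b\<in>Basis. (u \<bullet> b)\<^sup>2) \<le> 1" if "norm u \<le> 1" for u :: 'a
    using that power_mono[OF that, of 2]
    by (simp add: power2_eq_square euclidean_inner[symmetric]
        power2_norm_eq_inner[symmetric, unfolded power2_eq_square])
  show "(\<Sum>b\<in>Basis. (x s \<bullet> b)\<^sup>2) \<le> 1" for s by (rule *) (rule assms)
  show "(\<Sum>b\<in>Basis. (y t \<bullet> b)\<^sup>2) \<le> 1" for t by (rule *) (rule assms)
  show "C $ s $ t = (\<Sum>b\<in>Basis. x s \<bullet> b * (y t \<bullet> b))" for s t
    by (simp add: assms(3) euclidean_inner[of "x s" "y t"])
qed simp

text \<open>
  The direct sum of two vector systems, scaled by \<open>sqrt a\<close> and \<open>sqrt b\<close>, realizes \<open>a C + b D\<close>.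
\<close>

lemma convex_Cor: "convex (Cor :: (real^'n^'m) set)"
proof (rule convexI)
  fix C D :: "real^'n^'m" and a b :: real
  assume CD: "C \<in> Cor" "D \<in> Cor" and ab: "0 \<le> a" "0 \<le> b" "a + b = 1"
  obtain c and x :: "'m \<Rightarrow> nat \<Rightarrow> real" and y :: "'n \<Rightarrow> nat \<Rightarrow> real" where
    xy: "\<And>s. (\<Sum>i<c. (x s i)\<^sup>2) = 1" "\<And>t. (\<Sum>i<c. (y t i)\<^sup>2) = 1"
      "\<And>s t. C $ s $ t = (\<Sum>i<c. x s i * y t i)"
    using CD(1) by (auto simp: Cor_def)
  obtain d and u :: "'m \<Rightarrow> nat \<Rightarrow> real" and v :: "'n \<Rightarrow> nat \<Rightarrow> real" where
    uv: "\<And>s. (\<Sum>i<d. (u s i)\<^sup>2) = 1" "\<And>t. (\<Sum>i<d. (v t i)\<^sup>2) = 1"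
      "\<And>s t. D $ s $ t = (\<Sum>i<d. u s i * v t i)"
    using CD(2) by (auto simp: Cor_def)
  have mult: "sqrt r * p * (sqrt r * q) = r * (p * q)" if "0 \<le> r" for r p q :: real
    using that by (simp add: mult.assoc mult.left_commute[of p] real_sqrt_mult_self
        flip: mult.assoc[of "sqrt r" "sqrt r"])
  have sq: "(sqrt r * p)\<^sup>2 = r * p\<^sup>2" if "0 \<le> r" for r p :: real
    using that by (simp add: power_mult_distrib)
  define f where "f s = case_sum (\<lambda>i. sqrt a * x s i) (\<lambda>i. sqrt b * u s i)" for s
  define g where "g t = case_sum (\<lambda>i. sqrt a * y t i) (\<lambda>i. sqrt b * v t i)" for t
  have "(\<Sum>i\<in>{..<c} <+> {..<d}. (f s i)\<^sup>2) \<le> 1" for s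
    using ab by (simp add: sum.Plus f_def sq flip: sum_distrib_left) (simp add: xy uv)
  moreover have "(\<Sum>i\<in>{..<c} <+> {..<d}. (g t i)\<^sup>2) \<le> 1" for t
    using ab by (simp add: sum.Plus g_def sq flip: sum_distrib_left) (simp add: xy uv)
  moreover have "(a *\<^sub>R C + b *\<^sub>R D) $ s $ t = (\<Sum>i\<in>{..<c} <+> {..<d}. f s i * g t i)" for s t
    using ab by (simp add: sum.Plus f_def g_def mult flip: sum_distrib_left) (simp add: xy uv)
  ultimately show "a *\<^sub>R C + b *\<^sub>R D \<in> Cor"
    by (intro Cor_memI_finite[of "{..<c} <+> {..<d}" f g]) auto
qed

text \<open>
  Otherwise \<open>C\<close> would be the midpoint of two different points of \<open>S\<close>. All consequences of extremality
  except the purity of the state are drawn in this form.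
\<close>

lemma extreme_point_no_perturbation:
  fixes C :: "'a::euclidean_space"
  assumes "C extreme_point_of S" "C + E \<in> S" "C - E \<in> S"
  shows "E = 0"
proof (rule ccontr)
  assume "E \<noteq> 0"
  then have "C + E \<noteq> C - E"
    by (simp add: eq_neg_iff_add_eq_0 flip: add_uminus_conv_diff scaleR_2)
  then have "midpoint (C + E) (C - E) \<in> open_segment (C + E) (C - E)" by simp
  moreover have "midpoint (C + E) (C - E) = C"
    by (simp add: midpoint_def scaleR_2[symmetric])
  ultimately show False using assms by (auto simp: extreme_point_of_def)
qed

section \<open>Positive semidefinite operators\<close>

lemma psd_Cauchy_Schwarz:
  fixes P :: "'a::real_inner \<Rightarrow> 'a"
  assumes lin: "linear P" and sym: "\<And>u w. P u \<bullet> w = u \<bullet> P w" and pos: "\<And>u. 0 \<le> u \<bullet> P u"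
  shows "(u \<bullet> P b)\<^sup>2 \<le> (u \<bullet> P u) * (b \<bullet> P b)"
proof -
  have ex: "(u - t *\<^sub>R b) \<bullet> P (u - t *\<^sub>R b) = u \<bullet> P u - 2 * t * (u \<bullet> P b) + t\<^sup>2 * (b \<bullet> P b)" for t
    using sym[of u b] by (simp add: linear_diff[OF lin] linear_cmul[OF lin] inner_diff_left inner_diff_right
        inner_commute power2_eq_square algebra_simps)
  have q: "0 \<le> u \<bullet> P u - 2 * t * (u \<bullet> P b) + t\<^sup>2 * (b \<bullet> P b)" for t
    using pos[of "u - t *\<^sub>R b"] ex by simp
  show ?thesis
  proof (cases "b \<bullet> P b = 0")
    case True
    have "u \<bullet> P b = 0"
    proof (rule ccontr)
      assume "u \<bullet> P b \<noteq> 0"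
      then show False
        using q[of "(u \<bullet> P u + 1) / (2 * (u \<bullet> P b))"] True by simp
    qed
    then show ?thesis using True by simp
  next
    case False
    then have "b \<bullet> P b > 0" using pos[of b] by simp
    then show ?thesis
      using q[of "(u \<bullet> P b) / (b \<bullet> P b)"]
      by (simp add: field_simps power2_eq_square)
  qed
qed

lemma psd_null_vector:
  fixes P :: "'a::real_inner \<Rightarrow> 'a"
  assumes "linear P" "\<And>u w. P u \<bullet> w = u \<bullet> P w" "\<And>u. 0 \<le> u \<bullet> P u" "b \<bullet> P b = 0"
  shows "P b = 0"
  using psd_Cauchy_Schwarz[OF assms(1-3), of "P b" b] assms(4) by simp

text \<open>
  A Cholesky decomposition in place of a spectral theorem. Subtracting the rank-one operator
  \<open>u \<mapsto> (P b \<bullet> u) P b / (b \<bullet> P b)\<close> keeps positivity by Cauchy--Schwarz, makes the diagonal entry at \<open>b\<close>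
  zero and leaves zero diagonal entries zero; once the whole diagonal is zero, so is the operator, again
  by Cauchy--Schwarz.
\<close>

lemma psd_sum_rank_one:
  fixes P :: "'a::euclidean_space \<Rightarrow> 'a"
  assumes "linear P" "\<And>u w. P u \<bullet> w = u \<bullet> P w" "\<And>u. 0 \<le> u \<bullet> P u"
  shows "\<exists>(N::nat) w. \<forall>u. P u = (\<Sum>i<N. (w i \<bullet> u) *\<^sub>R w i)"
  using assms
proof (induction "card {b\<in>Basis. b \<bullet> P b \<noteq> 0}" arbitrary: P rule: less_induct)
  case less
  note lin = less.prems(1) and sym = less.prems(2) and pos = less.prems(3)
  show ?case
  proof (cases "\<exists>b\<in>Basis. b \<bullet> P b \<noteq> 0")
    case False
    then have "P b = 0" if "b \<in> Basis" for b
      using psd_null_vector[OF lin sym pos] that by blast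
    then have "P u = 0" for u
      using linear_eq_on_span[OF lin linear_zero, of Basis] by auto
    then show ?thesis by (intro exI[of _ 0]) simp
  next
    case True
    then obtain b where b: "b \<in> Basis" "b \<bullet> P b \<noteq> 0" by blast
    define w where "w = (1 / sqrt (b \<bullet> P b)) *\<^sub>R P b"
    have bpos: "b \<bullet> P b > 0" using b pos[of b] by simp
    have wu: "(w \<bullet> u) *\<^sub>R w = ((P b \<bullet> u) / (b \<bullet> P b)) *\<^sub>R P b" for u
      using bpos by (simp add: w_def)
    define Q where "Q u = P u - (w \<bullet> u) *\<^sub>R w" for u
    have linQ: "linear Q"
      by (rule linearI) (simp_all add: Q_def linear_add[OF lin] linear_cmul[OF lin] algebra_simps)
    have symQ: "Q u \<bullet> v = u \<bullet> Q v" for u v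
      using sym[of u v] by (simp add: Q_def inner_diff_left inner_diff_right inner_commute[of w])
    have uQ: "u \<bullet> Q u = u \<bullet> P u - (w \<bullet> u)\<^sup>2" for u
      by (simp add: Q_def inner_diff_right inner_commute[of u w] power2_eq_square)
    have wu2: "(w \<bullet> u)\<^sup>2 = (u \<bullet> P b)\<^sup>2 / (b \<bullet> P b)" for u
      using bpos by (simp add: w_def power_divide power_mult_distrib inner_commute)
    have posQ: "0 \<le> u \<bullet> Q u" for u
      using psd_Cauchy_Schwarz[OF lin sym pos, of u b] bpos
      by (simp add: uQ wu2 field_simps)
    have bQ: "b \<bullet> Q b = 0"
      unfolding uQ wu2 using bpos by (simp add: power2_eq_square)
    have "{c\<in>Basis. c \<bullet> Q c \<noteq> 0} \<subset> {c\<in>Basis. c \<bullet> P c \<noteq> 0}"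
    proof
      show "{c\<in>Basis. c \<bullet> Q c \<noteq> 0} \<subseteq> {c\<in>Basis. c \<bullet> P c \<noteq> 0}"
      proof clarify
        fix c assume "c \<bullet> Q c \<noteq> 0" "c \<bullet> P c = 0"
        then show False using posQ[of c] uQ[of c] zero_le_power2[of "w \<bullet> c"] by linarith
      qed
      show "{c\<in>Basis. c \<bullet> Q c \<noteq> 0} \<noteq> {c\<in>Basis. c \<bullet> P c \<noteq> 0}"
        using b bQ by blast
    qed
    then have "card {c\<in>Basis. c \<bullet> Q c \<noteq> 0} < card {c\<in>Basis. c \<bullet> P c \<noteq> 0}"
      by (intro psubset_card_mono) simp_all
    from less.hyps[OF this linQ symQ posQ] obtain N :: nat and z where
      z: "\<And>u. Q u = (\<Sum>i<N. (z i \<bullet> u) *\<^sub>R z i)" by blast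
    have "P u = (\<Sum>i<Suc N. ((z(N := w)) i \<bullet> u) *\<^sub>R (z(N := w)) i)" for u
      using z[of u] by (simp add: Q_def algebra_simps)
    then show ?thesis by blast
  qed
qed

section \<open>Hermitian complex matrices as real operators\<close>

lemma matrix_vector_scaleR:
  fixes A :: "complex^'d^'d"
  shows "A *v (r *\<^sub>R u) = r *\<^sub>R (A *v u)" and "(r *\<^sub>R A) *v u = r *\<^sub>R (A *v u)"
  by (simp_all add: vec_eq_iff matrix_vector_mult_def scaleR_sum_right)

lemma linear_matrix_vector: "linear ((*v) (A :: complex^'d^'d))"
  by (rule linearI) (simp_all add: matrix_vector_right_distrib matrix_vector_scaleR)

lemma hermitian_self_adjoint:
  fixes A :: "complex^'d^'d"
  assumes "hermitian A"
  shows "(A *v u) \<bullet> w = u \<bullet> (A *v w)"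
proof -
  have c: "(a * p) \<bullet> q = p \<bullet> (cnj a * q)" for a p q :: complex
    by (simp add: inner_complex_def algebra_simps)
  have h: "cnj (A $ i $ j) = A $ j $ i" for i j
    using assms unfolding hermitian_def by (metis complex_cnj_cnj)
  have "(A *v u) \<bullet> w = (\<Sum>i\<in>UNIV. \<Sum>j\<in>UNIV. u $ j \<bullet> (A $ j $ i * w $ i))"
    by (simp add: inner_vec_def matrix_vector_mult_def inner_sum_left c h)
  also have "\<dots> = (\<Sum>j\<in>UNIV. \<Sum>i\<in>UNIV. u $ j \<bullet> (A $ j $ i * w $ i))"
    by (rule sum.swap)
  also have "\<dots> = u \<bullet> (A *v w)"
    by (simp add: inner_vec_def matrix_vector_mult_def inner_sum_right)
  finally show ?thesis .
qed

lemma hermitian_psd_inner: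
  assumes "hermitian_psd A"
  shows "0 \<le> u \<bullet> (A *v u)"
proof -
  have "u \<bullet> (A *v u) = Re (\<Sum>i\<in>UNIV. cnj (u $ i) * (A *v u) $ i)"
    by (simp add: inner_vec_def inner_complex_def)
  then show ?thesis using assms by (simp add: hermitian_psd_def)
qed

text \<open>
  Let \<open>z\<close> maximize \<open>norm (A *v z) = l\<close> on the unit sphere. Then \<open>l\<^sup>2 - A\<^sup>2\<close> is positive semidefinite and
  its quadratic form vanishes at \<open>z\<close>, so \<open>(A - l) (A + l) z = 0\<close> and one of \<open>l\<close>, \<open>- l\<close> is an eigenvalue.
\<close>

lemma hermitian_contraction:
  fixes A :: "complex^'d^'d"
  assumes herm: "hermitian A" and spec: "spectrum A \<subseteq> complex_of_real ` {-1..1}"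
  shows "norm (A *v u) \<le> norm u"
proof -
  note adj = hermitian_self_adjoint[OF herm]
  have cont: "continuous_on (sphere 0 1) (\<lambda>u. norm (A *v u))"
    by (intro continuous_on_norm linear_continuous_on linear_linear[THEN iffD2] linear_matrix_vector)
  obtain e :: "complex^'d" where "norm e = 1" by (rule vector_choose_size[of 1]) auto
  then have "sphere (0 :: complex^'d) 1 \<noteq> {}" by auto
  from continuous_attains_sup[OF compact_sphere this cont]
  obtain z where z: "norm z = 1" and max: "\<And>u. norm u = 1 \<Longrightarrow> norm (A *v u) \<le> norm (A *v z)"
    by (auto simp: dist_norm)
  define l where "l = norm (A *v z)"
  have le: "norm (A *v u) \<le> l * norm u" for u
  proof (cases "u = 0")
    case False
    have "norm (A *v ((1 / norm u) *\<^sub>R u)) \<le> l"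
      unfolding l_def by (rule max) (use False in simp)
    then show ?thesis using False by (simp add: matrix_vector_scaleR field_simps)
  qed simp
  define P where "P u = l\<^sup>2 *\<^sub>R u - A *v (A *v u)" for u
  have linP: "linear P"
    by (rule linearI) (simp_all add: P_def matrix_vector_right_distrib matrix_vector_scaleR algebra_simps)
  have symP: "P u \<bullet> w = u \<bullet> P w" for u w
    by (simp add: P_def inner_diff_left inner_diff_right adj)
  have uP: "u \<bullet> P u = (l * norm u)\<^sup>2 - (norm (A *v u))\<^sup>2" for u
    by (simp add: P_def inner_diff_right adj[symmetric] power_mult_distrib power2_norm_eq_inner)
  have posP: "0 \<le> u \<bullet> P u" for u
    using power_mono[OF le[of u], of 2] by (simp add: uP)
  have "z \<bullet> P z = 0" by (simp add: uP z l_def)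
  then have "P z = 0" by (rule psd_null_vector[OF linP symP posP])
  then have AA: "A *v (A *v z) = l\<^sup>2 *\<^sub>R z" by (simp add: P_def)
  have eig: "\<bar>r\<bar> \<le> 1" if "A *v w = r *\<^sub>R w" "w \<noteq> 0" for r w
  proof -
    have "A *v w = complex_of_real r *s w"
      using that(1) by (simp add: vec_eq_iff) (simp add: scaleR_conv_of_real)
    then have "complex_of_real r \<in> spectrum A" using that(2) by (auto simp: spectrum_def)
    then obtain q where "complex_of_real r = complex_of_real q" "q \<in> {-1..1}"
      using spec by blast
    then show ?thesis by (simp add: abs_le_iff)
  qed
  have "l \<le> 1"
  proof (cases "A *v z + l *\<^sub>R z = 0")
    case True
    then have "A *v z = (- l) *\<^sub>R z" by (simp add: eq_neg_iff_add_eq_0)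
    then show ?thesis using eig[of z "- l"] z by force
  next
    case False
    have "A *v (A *v z + l *\<^sub>R z) = l *\<^sub>R (A *v z + l *\<^sub>R z)"
      by (simp add: matrix_vector_right_distrib matrix_vector_scaleR AA algebra_simps power2_eq_square)
    then show ?thesis using eig False by force
  qed
  then have "l * norm u \<le> norm u" by (simp add: mult_left_le_one_le l_def)
  then show ?thesis using le[of u] by linarith
qed

section \<open>Reduction to a pure state\<close>

text \<open>
  The factor 2 appears because each complex coordinate contributes the two real basis directions
  \<open>1\<close> and \<open>\<i>\<close>.
\<close>

lemma real_trace_complex_matrix:
  fixes A :: "complex^'d^'d"
  shows "(\<Sum>b\<in>Basis. b \<bullet> (A *v b)) = 2 * Re (trace A)"
proof -
  have B: "(Basis :: (complex^'d) set) = (\<lambda>(i, u). axis i u) ` (UNIV \<times> {1, \<i>})"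
    by (auto simp: Basis_vec_def Basis_complex_def)
  have inj: "inj_on (\<lambda>(i, u). axis i u :: complex^'d) (UNIV \<times> {1, \<i>})"
    by (auto simp: inj_on_def axis_eq_axis)
  have comp: "(A *v axis i c) $ i = A $ i $ i * c" for i c
    by (simp add: matrix_vector_mult_def axis_def if_distrib cong: if_cong)
  have "(\<Sum>b\<in>Basis. b \<bullet> (A *v b)) =
      (\<Sum>(i, u)\<in>UNIV \<times> {1, \<i>}. axis i u \<bullet> (A *v axis i u))"
    unfolding B sum.reindex[OF inj] by (simp add: case_prod_unfold o_def)
  also have "\<dots> = (\<Sum>i\<in>UNIV. \<Sum>u\<in>{1, \<i>}. axis i u \<bullet> (A *v axis i u))"
    by (rule sum.cartesian_product[symmetric])
  also have "\<dots> = (\<Sum>i\<in>UNIV. 2 * Re (A $ i $ i))"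
    by (intro sum.cong refl) (simp add: inner_axis' comp inner_complex_def)
  also have "\<dots> = 2 * Re (trace A)"
    by (simp add: trace_def sum_distrib_left)
  finally show ?thesis .
qed

lemma trace_rank_one_sum:
  fixes L W :: "complex^'d^'d"
  assumes W: "\<And>u. W *v u = (\<Sum>i<(N::nat). (w i \<bullet> u) *\<^sub>R w i)"
  shows "2 * Re (trace (L ** W)) = (\<Sum>i<N. w i \<bullet> (L *v w i))"
proof -
  note lin = linear_matrix_vector[of L]
  have "2 * Re (trace (L ** W)) = (\<Sum>b\<in>Basis. b \<bullet> (L *v (W *v b)))"
    by (simp add: real_trace_complex_matrix[symmetric] matrix_vector_mul_assoc)
  also have "\<dots> = (\<Sum>b\<in>Basis. \<Sum>i<N. (w i \<bullet> b) * ((L *v w i) \<bullet> b))"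
    by (simp add: W linear_sum[OF lin] linear_cmul[OF lin] inner_sum_right inner_commute[of _ "L *v _"])
  also have "\<dots> = (\<Sum>i<N. \<Sum>b\<in>Basis. (w i \<bullet> b) * ((L *v w i) \<bullet> b))"
    by (rule sum.swap)
  also have "\<dots> = (\<Sum>i<N. w i \<bullet> (L *v w i))"
    by (intro sum.cong refl) (rule euclidean_inner[symmetric])
  finally show ?thesis .
qed

text \<open>
  If \<open>W\<close> is the sum of the rank-one operators of the vectors \<open>w\<^sub>i\<close>, then the real trace formula gives
  \<open>C = \<Sum>\<^sub>i (\<parallel>w\<^sub>i\<parallel>\<^sup>2 / 2) D\<^sub>i\<close>, where \<open>D\<^sub>i\<close> is the correlation matrix of the normalized vector \<open>w\<^sub>i\<close> and the
  weights add up to the trace of \<open>W\<close>. An extreme point in the convex hull of the \<open>D\<^sub>i\<close> is one of them.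
\<close>

lemma extreme_rep_pure_state:
  fixes C :: "real^'n^'m" and W :: "complex^'d^'d"
  assumes ext: "C extreme_point_of Cor" and rep: "commuting_operator_rep C W X Y"
  obtains v where "norm v = 1" "\<And>s t. C $ s $ t = (X s *v v) \<bullet> (Y t *v v)"
proof -
  have psd: "hermitian_psd W" and hW: "hermitian W" and tr: "trace W = 1"
    and hX: "\<And>s. hermitian (X s)" and sX: "\<And>s. spectrum (X s) \<subseteq> complex_of_real ` {-1..1}"
    and hY: "\<And>t. hermitian (Y t)" and sY: "\<And>t. spectrum (Y t) \<subseteq> complex_of_real ` {-1..1}"
    and C: "\<And>s t. complex_of_real (C $ s $ t) = trace (X s ** Y t ** W)"
    using rep by (auto simp: commuting_operator_rep_def hermitian_psd_def)
  obtain N :: nat and w where w: "\<And>u. W *v u = (\<Sum>i<N. (w i \<bullet> u) *\<^sub>R w i)"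
    using psd_sum_rank_one[OF linear_matrix_vector hermitian_self_adjoint[OF hW] hermitian_psd_inner[OF psd]]
    by blast
  have one: "(\<Sum>i<N. (norm (w i))\<^sup>2 / 2) = 1"
    using trace_rank_one_sum[OF w, of "mat 1"]
    by (simp add: tr power2_norm_eq_inner flip: sum_divide_distrib)
  have C2: "2 * C $ s $ t = (\<Sum>i<N. (X s *v w i) \<bullet> (Y t *v w i))" for s t
    using trace_rank_one_sum[OF w, of "X s ** Y t"] C[of s t, symmetric]
    by (simp add: matrix_vector_mul_assoc[symmetric] hermitian_self_adjoint[OF hX])
  define I where "I = {i. i < N \<and> w i \<noteq> 0}"
  define v where "v i = (1 / norm (w i)) *\<^sub>R w i" for i
  define D :: "nat \<Rightarrow> real^'n^'m" where "D i = (\<chi> s t. (X s *v v i) \<bullet> (Y t *v v i))" for i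
  have fin: "finite I" by (simp add: I_def)
  have nv: "norm (v i) = 1" if "i \<in> I" for i using that by (simp add: v_def I_def)
  have "(\<Sum>i\<in>I. (norm (w i))\<^sup>2 / 2) = (\<Sum>i<N. (norm (w i))\<^sup>2 / 2)"
    by (rule sum.mono_neutral_left) (auto simp: I_def)
  then have one': "(\<Sum>i\<in>I. (norm (w i))\<^sup>2 / 2) = 1" using one by simp
  have sumC: "C = (\<Sum>i\<in>I. ((norm (w i))\<^sup>2 / 2) *\<^sub>R D i)"
  proof (intro vec_eq_iff[THEN iffD2] allI)
    fix s t
    have "(\<Sum>i\<in>I. ((norm (w i))\<^sup>2 / 2) *\<^sub>R D i) $ s $ t
        = (\<Sum>i\<in>I. (X s *v w i) \<bullet> (Y t *v w i) / 2)"
      unfolding sum_component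
      by (intro sum.cong refl)
        (simp add: D_def v_def matrix_vector_scaleR I_def power2_eq_square)
    also have "\<dots> = (\<Sum>i<N. (X s *v w i) \<bullet> (Y t *v w i) / 2)"
      by (rule sum.mono_neutral_left) (auto simp: I_def)
    also have "\<dots> = C $ s $ t" by (simp add: C2[symmetric] flip: sum_divide_distrib)
    finally show "C $ s $ t = (\<Sum>i\<in>I. ((norm (w i))\<^sup>2 / 2) *\<^sub>R D i) $ s $ t" by simp
  qed
  have "D i \<in> Cor" if "i \<in> I" for i
    using hermitian_contraction[OF hX sX, of _ "v i"] hermitian_contraction[OF hY sY, of _ "v i"]
    by (intro Cor_memI_inner[of "\<lambda>s. X s *v v i" "\<lambda>t. Y t *v v i"]) (auto simp: nv[OF that] D_def)
  then have sub: "convex hull (D ` I) \<subseteq> Cor"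
    by (intro hull_minimal convex_Cor) auto
  have "C \<in> convex hull (D ` I)"
    unfolding sumC by (rule convex_sum[OF fin convex_convex_hull one']) (auto intro: hull_inc)
  then have "C extreme_point_of (convex hull (D ` I))"
    using ext sub by (auto simp: extreme_point_of_def)
  then obtain i where "i \<in> I" "C = D i"
    using extreme_point_of_convex_hull by blast
  then show ?thesis using that[of "v i"] nv by (simp add: D_def)
qed

section \<open>Rigidity of extreme correlation matrices\<close>

lemma Cor_transpose:
  fixes C :: "real^'n^'m"
  assumes "C \<in> Cor"
  shows "transpose C \<in> Cor"
proof -
  obtain d and x :: "'m \<Rightarrow> nat \<Rightarrow> real" and y :: "'n \<Rightarrow> nat \<Rightarrow> real" where
    "\<And>s. (\<Sum>i<d. (x s i)\<^sup>2) = 1" "\<And>t. (\<Sum>i<d. (y t i)\<^sup>2) = 1"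
      "\<And>s t. C $ s $ t = (\<Sum>i<d. x s i * y t i)"
    using assms by (auto simp: Cor_def)
  then show ?thesis
    by (intro Cor_memI_finite[of "{..<d}" y x]) (auto simp: transpose_def mult.commute)
qed

text \<open>
  Exchanging the roles of the \<open>x\<^sub>s\<close> and the \<open>y\<^sub>t\<close> lets each of the following statements be proved for
  the rows only.
\<close>

lemma extreme_point_Cor_transpose:
  fixes C :: "real^'n^'m"
  assumes "C extreme_point_of Cor"
  shows "transpose C extreme_point_of Cor"
proof -
  have "linear (transpose :: real^'n^'m \<Rightarrow> real^'m^'n)"
    by (rule linearI) (simp_all add: transpose_def vec_eq_iff)
  moreover have "inj (transpose :: real^'n^'m \<Rightarrow> real^'m^'n)"
    by (metis injI transpose_transpose)
  ultimately have seg: "transpose C \<in> open_segment (transpose a) (transpose b)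
      \<longleftrightarrow> C \<in> open_segment a b" for a b :: "real^'n^'m"
    by (simp add: open_segment_linear_image inj_image_mem_iff)
  show ?thesis
    unfolding extreme_point_of_def
  proof (intro conjI ballI)
    show "transpose C \<in> Cor"
      using assms by (simp add: extreme_point_of_def Cor_transpose)
    fix a b :: "real^'m^'n" assume "a \<in> Cor" "b \<in> Cor"
    then have "C \<notin> open_segment (transpose a) (transpose b)"
      using assms Cor_transpose by (auto simp: extreme_point_of_def)
    then show "transpose C \<notin> open_segment a b"
      using seg[of "transpose a" "transpose b"] by (simp add: transpose_transpose)
  qed
qed

text \<open>
  If \<open>x\<^sub>r\<close> is shorter than one, it may be moved by any short vector \<open>h\<close> and by \<open>- h\<close>, so
  \<open>\<langle>h, y\<^sub>t\<rangle> = 0\<close>; the choice of \<open>h\<close> parallel to \<open>y\<^sub>t\<close> forces \<open>y\<^sub>t = 0\<close>.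
\<close>

lemma extreme_slack:
  fixes C :: "real^'n^'m" and x :: "'m \<Rightarrow> 'a::euclidean_space"
  assumes ext: "C extreme_point_of Cor"
    and x: "\<And>s. norm (x s) \<le> 1" and y: "\<And>t. norm (y t) \<le> 1"
    and C: "\<And>s t. C $ s $ t = x s \<bullet> y t"
    and slack: "norm (x r) < 1"
  shows "y t = 0"
proof -
  define h where "h = (1 - norm (x r)) *\<^sub>R y t"
  define E :: "real^'n^'m" where "E = (\<chi> s t. if s = r then h \<bullet> y t else 0)"
  have h: "norm h \<le> 1 - norm (x r)"
    using slack y[of t] by (simp add: h_def mult_left_le)
  have "norm (x r + h) \<le> 1" "norm (x r - h) \<le> 1"
    using h norm_triangle_ineq[of "x r" h] norm_triangle_ineq4[of "x r" h] by linarith+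
  then have "C + E \<in> Cor" "C - E \<in> Cor"
    by (intro Cor_memI_inner[of "x(r := x r + h)" y] Cor_memI_inner[of "x(r := x r - h)" y];
        simp add: x y C E_def inner_add_left inner_diff_left)+
  then have "E = 0" by (rule extreme_point_no_perturbation[OF ext])
  then have "E $ r $ t = 0" by simp
  then show ?thesis using slack by (simp add: E_def h_def)
qed

text \<open>
  A vector \<open>x\<^sub>s\<close> with slack makes all \<open>y\<^sub>t\<close> zero, hence \<open>C = 0\<close>; but the zero matrix is the midpoint of
  the all-ones matrix and its negative, both of which are correlation matrices.
\<close>

lemma extreme_unit:
  fixes C :: "real^'n^'m" and x :: "'m \<Rightarrow> 'a::euclidean_space"
  assumes ext: "C extreme_point_of Cor"
    and x: "\<And>s. norm (x s) \<le> 1" and y: "\<And>t. norm (y t) \<le> 1"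
    and C: "\<And>s t. C $ s $ t = x s \<bullet> y t"
  shows "norm (x s) = 1"
proof (rule ccontr)
  assume "norm (x s) \<noteq> 1"
  then have "norm (x s) < 1" using x[of s] by simp
  then have y0: "y t = 0" for t by (rule extreme_slack[OF ext x y C])
  define J :: "real^'n^'m" where "J = (\<chi> s t. 1)"
  obtain e :: 'a where e: "norm e = 1" by (rule vector_choose_size[of 1]) auto
  then have "e \<bullet> e = 1" by (simp add: power2_norm_eq_inner[symmetric])
  then have "C + J \<in> Cor" "C - J \<in> Cor"
    by (intro Cor_memI_inner[of "\<lambda>_. e" "\<lambda>_. e"] Cor_memI_inner[of "\<lambda>_. e" "\<lambda>_. - e"];
        simp add: J_def C y0 e)+
  then have "J = 0" by (rule extreme_point_no_perturbation[OF ext])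
  then show False by (simp add: J_def vec_eq_iff)
qed

text \<open>
  Replacing \<open>x\<^sub>s\<close> by its projection onto the span of the \<open>y\<^sub>t\<close> does not change \<open>C\<close>. Since the projection
  must again be a unit vector, nothing was projected away.
\<close>

lemma extreme_span:
  fixes C :: "real^'n^'m" and x :: "'m \<Rightarrow> 'a::euclidean_space"
  assumes ext: "C extreme_point_of Cor"
    and x: "\<And>s. norm (x s) \<le> 1" and y: "\<And>t. norm (y t) \<le> 1"
    and C: "\<And>s t. C $ s $ t = x s \<bullet> y t"
  shows "x s \<in> span (range y)"
proof -
  obtain p q where p: "p \<in> span (range y)" and q: "\<And>w. w \<in> span (range y) \<Longrightarrow> orthogonal q w"
    and pq: "x s = p + q"
    using orthogonal_subspace_decomp_exists[of "range y" "x s"] by blast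
  have qy: "q \<bullet> y t = 0" for t using q[of "y t"] by (simp add: span_base orthogonal_def)
  have split: "(norm (x s))\<^sup>2 = (norm p)\<^sup>2 + (norm q)\<^sup>2"
    using norm_add_Pythagorean[of p q] q[OF p] pq by (simp add: orthogonal_commute)
  then have np: "norm p \<le> 1"
    using x[of s] by (metis le_add_same_cancel1 zero_le_power2 power2_le_imp_le norm_ge_zero order_trans)
  define x' where "x' = x(s := p)"
  have "norm (x' s) = 1"
    by (rule extreme_unit[OF ext, of x' y]) (auto simp: x'_def np x y C pq inner_add_left qy)
  then have "(norm q)\<^sup>2 \<le> 0"
    using split power_mono[OF x[of s], of 2] by (simp add: x'_def)
  then show ?thesis using p pq by simp
qed

text \<open>
  A symmetric form \<open>B\<close> with \<open>\<bar>B u u\<bar> \<le> K \<parallel>u\<parallel>\<^sup>2\<close> can be added with coefficient \<open>1 / K\<close> or \<open>- 1 / K\<close> to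
  the inner product without losing positivity. The perturbed forms are again sums of squares of linear
  functionals, and in the corresponding coordinates all \<open>x\<^sub>s\<close>, \<open>y\<^sub>t\<close> still have norm at most one,
  because \<open>B\<close> vanishes on their diagonal. So \<open>C\<close> moves in the two opposite directions \<open>\<plusminus> B (x\<^sub>s, y\<^sub>t) / K\<close>.
\<close>

lemma extreme_form_zero:
  fixes C :: "real^'n^'m" and x :: "'m \<Rightarrow> 'a::euclidean_space" and B :: "'a \<Rightarrow> 'a \<Rightarrow> real"
  assumes ext: "C extreme_point_of Cor"
    and x: "\<And>s. norm (x s) \<le> 1" and y: "\<And>t. norm (y t) \<le> 1"
    and C: "\<And>s t. C $ s $ t = x s \<bullet> y t"
    and bil: "bilinear B" and sym: "\<And>u w. B u w = B w u"
    and Bx: "\<And>s. B (x s) (x s) = 0" and By: "\<And>t. B (y t) (y t) = 0"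
  shows "B (x s) (y t) = 0"
proof -
  obtain K where K: "K > 0" "\<And>u w. norm (B u w) \<le> K * norm u * norm w"
    using bilinear_bounded_pos[OF bil] by blast
  have lin: "linear (B u)" for u using bil by (simp add: bilinear_def)
  define E :: "real^'n^'m" where "E = (\<chi> s t. B (x s) (y t) / K)"
  have mem: "C + c *\<^sub>R E \<in> Cor" if c: "\<bar>c\<bar> = 1" for c
  proof -
    define P where "P u = u + (c / K) *\<^sub>R (\<Sum>b\<in>Basis. B u b *\<^sub>R b)" for u
    have Pu: "P u \<bullet> w = u \<bullet> w + c / K * B u w" for u w
    proof -
      have "(\<Sum>b\<in>Basis. B u b * (b \<bullet> w)) = B u (\<Sum>b\<in>Basis. (w \<bullet> b) *\<^sub>R b)"
        by (simp only: linear_sum[OF lin] linear_cmul[OF lin]) (simp add: inner_commute mult.commute)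
      then show ?thesis
        by (simp add: P_def inner_add_left inner_sum_left euclidean_representation)
    qed
    have "linear P"
    proof
      show "P (u + z) = P u + P z" for u z
        by (rule euclidean_eqI) (simp add: Pu inner_add_left bilinear_ladd[OF bil] algebra_simps)
      show "P (r *\<^sub>R u) = r *\<^sub>R P u" for r u
        by (rule euclidean_eqI) (simp add: Pu bilinear_lmul[OF bil] algebra_simps)
    qed
    moreover have "P u \<bullet> w = u \<bullet> P w" for u w
      using Pu[of u w] Pu[of w u] sym[of u w] by (simp add: inner_commute)
    moreover have "0 \<le> u \<bullet> P u" for u
    proof -
      have pos: "0 \<le> b + a" if "\<bar>a\<bar> \<le> b" for a b :: real using that by linarith
      have "\<bar>c / K * B u u\<bar> \<le> u \<bullet> u"
        using K(2)[of u u] K(1) c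
        by (simp add: abs_mult field_simps power2_norm_eq_inner[symmetric] power2_eq_square)
      moreover have "u \<bullet> P u = u \<bullet> u + c / K * B u u"
        using Pu[of u u] by (simp only: inner_commute)
      ultimately show ?thesis using pos by simp
    qed
    ultimately obtain N :: nat and w where w: "\<And>u. P u = (\<Sum>i<N. (w i \<bullet> u) *\<^sub>R w i)"
      using psd_sum_rank_one[of P] by blast
    have g: "(\<Sum>i<N. (w i \<bullet> u) * (w i \<bullet> z)) = u \<bullet> z + c / K * B u z" for u z
      using Pu[of u z] by (simp add: w inner_sum_left)
    have n: "u \<bullet> u \<le> 1" if "norm u \<le> 1" for u :: 'a
      using power_mono[OF that, of 2] by (simp add: power2_norm_eq_inner)
    show ?thesis
      by (rule Cor_memI_finite[of "{..<N}" "\<lambda>s i. w i \<bullet> x s" "\<lambda>t i. w i \<bullet> y t"])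
        (simp_all add: power2_eq_square g Bx By n x y C E_def)
  qed
  have "E = 0"
    using mem[of 1] mem[of "-1"] by (intro extreme_point_no_perturbation[OF ext]) auto
  then have "E $ s $ t = 0" by simp
  then show ?thesis using K by (simp add: E_def)
qed

section \<open>Commuting Clifford families force a large dimension\<close>

text \<open>
  For one index \<open>j\<close>, the space \<open>V\<close> contains the direct sum of the eigenspaces of \<open>Z j\<close> for \<open>1\<close> and
  \<open>-1\<close>. Some eigenspace is nonzero, and then both are, since \<open>F j\<close> maps each injectively into the
  other. The operators with the other indices commute with \<open>Z j\<close>, so they act on both eigenspaces, and
  induction on the number of indices applies to each of them.
\<close>

lemma eigenspace_doubling:
  fixes Z F :: "'j \<Rightarrow> complex^'d \<Rightarrow> complex^'d"
  assumes "finite J" and "vec.subspace V" and "V \<noteq> {0}"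
    and linZ: "\<And>j. j \<in> J \<Longrightarrow> Vector_Spaces.linear (*s) (*s) (Z j)"
    and linF: "\<And>j. j \<in> J \<Longrightarrow> Vector_Spaces.linear (*s) (*s) (F j)"
    and ZV: "\<And>j u. j \<in> J \<Longrightarrow> u \<in> V \<Longrightarrow> Z j u \<in> V"
    and FV: "\<And>j u. j \<in> J \<Longrightarrow> u \<in> V \<Longrightarrow> F j u \<in> V"
    and ZZ: "\<And>j u. j \<in> J \<Longrightarrow> u \<in> V \<Longrightarrow> Z j (Z j u) = u"
    and FF: "\<And>j u. j \<in> J \<Longrightarrow> u \<in> V \<Longrightarrow> F j u = 0 \<Longrightarrow> u = 0"
    and FZ: "\<And>j u. j \<in> J \<Longrightarrow> u \<in> V \<Longrightarrow> F j (Z j u) = - Z j (F j u)"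
    and comZ: "\<And>i j u. i \<in> J \<Longrightarrow> j \<in> J \<Longrightarrow> i \<noteq> j \<Longrightarrow> u \<in> V \<Longrightarrow> Z i (Z j u) = Z j (Z i u)"
    and comF: "\<And>i j u. i \<in> J \<Longrightarrow> j \<in> J \<Longrightarrow> i \<noteq> j \<Longrightarrow> u \<in> V \<Longrightarrow> F i (Z j u) = Z j (F i u)"
  shows "2 ^ card J \<le> vec.dim V"
  using assms
proof (induction J arbitrary: V rule: finite_induct)
  case empty
  then have "vec.dim V \<noteq> 0" by (auto simp: vec.dim_eq_0 dest: vec.subspace_0)
  then show ?case by (simp del: vec.dim_eq_0)
next
  case (insert j J)
  note sub = \<open>vec.subspace V\<close>
  note linj = insert.prems(3)[of j, simplified] and linFj = insert.prems(4)[of j, simplified]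
  note ZZj = insert.prems(7)[of j, simplified]
  define E where "E c = {u \<in> V. Z j u = c *s u}" for c :: complex
  have subE: "vec.subspace (E c)" for c
  proof (rule vec.subspaceI)
    show "0 \<in> E c" by (simp add: E_def vec.subspace_0[OF sub] vec.linear_0[OF linj])
    show "u + w \<in> E c" if "u \<in> E c" "w \<in> E c" for u w
      using that by (simp add: E_def vec.subspace_add[OF sub] vec.linear_add[OF linj] vec.scale_right_distrib)
    show "a *s u \<in> E c" if "u \<in> E c" for a u
      using that by (simp add: E_def vec.subspace_scale[OF sub] vec.linear_scale[OF linj] mult.commute)
  qed
  have nonzero: "\<exists>u\<in>U. u \<noteq> 0" if "vec.subspace U" "U \<noteq> {0}" for U :: "(complex^'d) set"
    using that vec.subspace_0[OF that(1)] by auto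
  have EV: "E c \<subseteq> V" for c by (auto simp: E_def)
  have flip: "F j u \<in> E (- c)" if "u \<in> E c" for u c
  proof -
    have "Z j (F j u) = - F j (Z j u)" using insert.prems(9)[of j u] that by (simp add: E_def)
    also have "\<dots> = (- c) *s F j u"
      using that by (simp add: E_def vec.linear_scale[OF linFj])
    finally show ?thesis using that insert.prems(6)[of j u] by (simp add: E_def)
  qed
  have flip0: "E (- c) \<noteq> {0}" if ne: "E c \<noteq> {0}" for c
  proof -
    obtain u where u: "u \<in> E c" "u \<noteq> 0"
      using nonzero[OF subE ne] by metis
    then have "F j u \<noteq> 0" using insert.prems(8)[of j u] EV by auto
    then show ?thesis using flip[OF u(1)] by blast
  qed
  have plus: "u + Z j u \<in> E 1" and minus: "u - Z j u \<in> E (-1)" if "u \<in> V" for u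
    using that ZZj[OF that] insert.prems(5)[of j u]
    by (simp_all add: E_def vec.linear_add[OF linj] vec.linear_diff[OF linj]
        vec.subspace_add[OF sub] vec.subspace_diff[OF sub])
  have half: "u = (1/2) *s (u + Z j u) + (1/2) *s (u - Z j u)" for u
    by (simp add: vec_eq_iff field_simps)
  have nz: "E 1 \<noteq> {0}" "E (-1) \<noteq> {0}"
  proof -
    obtain u where u: "u \<in> V" "u \<noteq> 0" using nonzero[OF sub \<open>V \<noteq> {0}\<close>] by metis
    have "E 1 \<noteq> {0} \<or> E (-1) \<noteq> {0}"
    proof (rule ccontr)
      assume "\<not> ?thesis"
      then have "u + Z j u = 0" "u - Z j u = 0" using plus[OF u(1)] minus[OF u(1)] by auto
      then show False using half[of u] u(2) by simp
    qed
    then show "E 1 \<noteq> {0}" "E (-1) \<noteq> {0}" by (metis flip0 minus_minus)+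
  qed
  have IH: "2 ^ card J \<le> vec.dim (E c)" if "E c \<noteq> {0}" for c
  proof (rule insert.IH[OF subE that])
    fix i assume i: "i \<in> J"
    then have ij: "i \<noteq> j" using insert.hyps by auto
    show lini: "Vector_Spaces.linear (*s) (*s) (Z i)" "Vector_Spaces.linear (*s) (*s) (F i)"
      using insert.prems(3,4)[of i] i by simp_all
    fix u assume u: "u \<in> E c"
    then have uV: "u \<in> V" by (simp add: E_def)
    show "Z i u \<in> E c"
      using insert.prems(10)[of j i u] insert.prems(5)[of i u] i ij u
      by (simp add: E_def vec.linear_scale[OF lini(1)])
    show "F i u \<in> E c"
      using insert.prems(11)[of i j u] insert.prems(6)[of i u] i ij u
      by (simp add: E_def vec.linear_scale[OF lini(2)])
    show "Z i (Z i u) = u" "F i (Z i u) = - Z i (F i u)"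
      using insert.prems(7,9)[of i u] i uV by simp_all
    show "u = 0" if "F i u = 0"
      using insert.prems(8)[of i u] i uV that by simp
    fix l assume "l \<in> J" "i \<noteq> l"
    then show "Z i (Z l u) = Z l (Z i u)" "F i (Z l u) = Z l (F i u)"
      using insert.prems(10,11)[of i l u] i uV by simp_all
  qed
  have "E 1 \<inter> E (-1) = {0}"
  proof -
    have "u = 0" if "u \<in> E 1" "u \<in> E (-1)" for u
      using that half[of u] by (simp add: E_def)
    then show ?thesis using vec.subspace_0[OF subE] by blast
  qed
  then have "vec.dim {u + w |u w. u \<in> E 1 \<and> w \<in> E (-1)} = vec.dim (E 1) + vec.dim (E (-1))"
    using vec.dim_sums_Int[OF subE[of 1] subE[of "-1"]] by simp
  moreover have "vec.dim {u + w |u w. u \<in> E 1 \<and> w \<in> E (-1)} \<le> vec.dim V"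
    using EV by (intro vec.dim_subset) (auto intro!: vec.subspace_add[OF sub])
  ultimately show ?case using IH[OF nz(1)] IH[OF nz(2)] insert.hyps by simp
qed

text \<open>
  The involutions are \<open>\<i> G\<^sub>2\<^sub>j G\<^sub>2\<^sub>j\<^sub>+\<^sub>1\<close>, for each of the two families and each \<open>j < k\<close>. As even
  products they commute with all generators of other indices; the generator \<open>G\<^sub>2\<^sub>j\<close> anticommutes with
  its own involution and exchanges its eigenspaces. This makes \<open>2 k\<close> doublings.
\<close>

lemma commuting_Clifford_families_dim:
  fixes G :: "bool \<Rightarrow> nat \<Rightarrow> complex^'d^'d"
  assumes sub: "vec.subspace V" and nz: "V \<noteq> {0}"
    and inv: "\<And>b i u. i < 2 * k \<Longrightarrow> u \<in> V \<Longrightarrow> G b i *v u \<in> V"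
    and sq: "\<And>b i u. i < 2 * k \<Longrightarrow> u \<in> V \<Longrightarrow> G b i *v (G b i *v u) = u"
    and anti: "\<And>b i j u. i < 2 * k \<Longrightarrow> j < 2 * k \<Longrightarrow> i \<noteq> j \<Longrightarrow> u \<in> V \<Longrightarrow>
      G b i *v (G b j *v u) = - (G b j *v (G b i *v u))"
    and com: "\<And>b c i j u. i < 2 * k \<Longrightarrow> j < 2 * k \<Longrightarrow> b \<noteq> c \<Longrightarrow> u \<in> V \<Longrightarrow>
      G b i *v (G c j *v u) = G c j *v (G b i *v u)"
  shows "(2 ^ k)\<^sup>2 \<le> vec.dim V"
proof -
  define J where "J = (UNIV :: bool set) \<times> {..<k}"
  define Z where "Z = (\<lambda>(b, j) u. \<i> *s (G b (2*j) *v (G b (2*j+1) *v u)))"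
  define F where "F = (\<lambda>(b, j :: nat) u. G b (2*j) *v u)"
  have neg: "A *v (- u) = - (A *v u)" for A :: "complex^'d^'d" and u
    by (simp add: vec.linear_neg)
  \<comment> \<open>A product of two generators commutes with every generator different from both:
    in the same family two signs cancel.\<close>
  have even: "G b i *v (G c p *v (G c q *v u)) = G c p *v (G c q *v (G b i *v u))"
    if "i < 2 * k" "p < 2 * k" "q < 2 * k" "b = c \<Longrightarrow> i \<noteq> p \<and> i \<noteq> q" "u \<in> V" for b c i p q u
  proof (cases "b = c")
    case True
    then show ?thesis
      using that anti[of i p "G c q *v u" c] anti[of i q u c] inv[of q u c] by (simp add: neg)
  next
    case False
    then show ?thesis
      using that com[of i p b c "G c q *v u"] com[of i q b c u] inv[of q u c] by simp
  qed
  have "2 ^ card J \<le> vec.dim V"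
  proof (rule eigenspace_doubling[of J V Z F, OF _ sub nz])
    show "finite J" by (simp add: J_def)
  next
    fix j assume "j \<in> J"
    then obtain b i where j: "j = (b, i)" "i < k" by (auto simp: J_def)
    then have lt: "2 * i < 2 * k" "2 * i + 1 < 2 * k" by auto
    show "Vector_Spaces.linear (*s) (*s) (Z j)" "Vector_Spaces.linear (*s) (*s) (F j)"
      by (simp_all add: Z_def F_def j Vector_Spaces.linear_iff vec.vector_space_axioms
          vec.scale_right_distrib matrix_vector_right_distrib vector_scalar_commute mult.commute)
    fix u assume u: "u \<in> V"
    note in1 = inv[OF lt(1) u, of b] and in2 = inv[OF lt(2) u, of b]
    show "Z j u \<in> V" using inv[OF lt(1) in2, of b] by (simp add: Z_def j vec.subspace_scale[OF sub])
    show "F j u \<in> V" using in1 by (simp add: F_def j)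
    show "Z j (Z j u) = u"
      using anti[OF lt(2) lt(1) _ in2, of b] sq[OF lt(2) u, of b] sq[OF lt(1) u, of b]
      by (simp add: Z_def j vector_scalar_commute neg)
    show "u = 0" if "F j u = 0"
      using sq[OF lt(1) u, of b] that by (simp add: F_def j)
    show "F j (Z j u) = - Z j (F j u)"
      using anti[OF lt(2) lt(1) _ u, of b] by (simp add: Z_def F_def j vector_scalar_commute neg)
    fix j' assume "j' \<in> J" and ne: "j \<noteq> j'"
    then obtain c p where j': "j' = (c, p)" "p < k" by (auto simp: J_def)
    have lt': "2 * p < 2 * k" "2 * p + 1 < 2 * k" using j' by auto
    have dist: "b = c \<Longrightarrow> i \<noteq> p" using ne j j' by auto
    have ev: "G b (2*i) *v (G c (2*p) *v (G c (2*p+1) *v w)) = G c (2*p) *v (G c (2*p+1) *v (G b (2*i) *v w))"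
      "G b (2*i+1) *v (G c (2*p) *v (G c (2*p+1) *v w)) = G c (2*p) *v (G c (2*p+1) *v (G b (2*i+1) *v w))"
      if "w \<in> V" for w
      by (rule even; use lt lt' dist that in \<open>presburger | simp\<close>)+
    show "F j (Z j' u) = Z j' (F j u)"
      using ev(1)[OF u] by (simp add: Z_def F_def j j' vector_scalar_commute)
    show "Z j (Z j' u) = Z j' (Z j u)"
      using ev(2)[OF u] ev(1)[OF in2] by (simp add: Z_def j j' vector_scalar_commute)
  qed
  moreover have "card J = k * 2" by (simp add: J_def card_cartesian_product)
  ultimately show ?thesis by (simp add: power_mult)
qed

section \<open>Orbits of a vector under a commutant\<close>

text \<open>
  The commutant of a set of matrices consists here of complex-linear maps rather than matrices, which
  makes composition and pointwise operations immediate.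
\<close>

definition commutant :: "(complex^'d^'d) set \<Rightarrow> (complex^'d \<Rightarrow> complex^'d) set" where
  "commutant S = {p. Vector_Spaces.linear (*s) (*s) p \<and> (\<forall>A\<in>S. \<forall>u. A *v p u = p (A *v u))}"

definition commutant_orbit :: "(complex^'d^'d) set \<Rightarrow> complex^'d \<Rightarrow> (complex^'d) set" where
  "commutant_orbit S v = (\<lambda>p. p v) ` commutant S"

lemma commutantI:
  assumes "\<And>u w. p (u + w) = p u + p w" "\<And>c u. p (c *s u) = c *s p u"
    and "\<And>A u. A \<in> S \<Longrightarrow> A *v p u = p (A *v u)"
  shows "p \<in> commutant S"
  using assms by (simp add: commutant_def Vector_Spaces.linear_iff vec.vector_space_axioms)

lemma commutantD:
  assumes "p \<in> commutant S"
  shows "p (u + w) = p u + p w" "p (c *s u) = c *s p u" "A \<in> S \<Longrightarrow> A *v p u = p (A *v u)"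
  using assms by (simp_all add: commutant_def Vector_Spaces.linear_iff)

lemma commutant_orbitI:
  assumes "p \<in> commutant S" "w = p v"
  shows "w \<in> commutant_orbit S v"
  using assms by (simp add: commutant_orbit_def)

lemma commutant_orbitE:
  assumes "w \<in> commutant_orbit S v"
  obtains p where "p \<in> commutant S" "w = p v"
  using assms by (auto simp: commutant_orbit_def)

lemma subspace_commutant_orbit: "vec.subspace (commutant_orbit S v)"
proof (rule vec.subspaceI)
  have "(\<lambda>_. 0) \<in> commutant S"
    by (rule commutantI) simp_all
  then show "0 \<in> commutant_orbit S v" by (rule commutant_orbitI) simp
next
  fix a b assume "a \<in> commutant_orbit S v" "b \<in> commutant_orbit S v"
  then obtain p q where pq: "a = p v" "b = q v" "p \<in> commutant S" "q \<in> commutant S"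
    by (auto elim!: commutant_orbitE)
  have "(\<lambda>u. p u + q u) \<in> commutant S"
    by (rule commutantI)
      (simp_all add: commutantD[OF pq(3)] commutantD[OF pq(4)] matrix_vector_right_distrib vec.scale_right_distrib)
  then show "a + b \<in> commutant_orbit S v" by (rule commutant_orbitI) (simp add: pq)
next
  fix c a assume "a \<in> commutant_orbit S v"
  then obtain p where p: "a = p v" "p \<in> commutant S" by (auto elim!: commutant_orbitE)
  have "(\<lambda>u. c *s p u) \<in> commutant S"
    by (rule commutantI)
      (simp_all add: commutantD[OF p(2)] vector_scalar_commute vec.scale_right_distrib mult.commute)
  then show "c *s a \<in> commutant_orbit S v" by (rule commutant_orbitI) (simp add: p)
qed

lemma commutant_scaleR:
  assumes "p \<in> commutant S"
  shows "p (r *\<^sub>R u) = r *\<^sub>R p u"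
proof -
  have r: "r *\<^sub>R w = complex_of_real r *s w" for w :: "complex^'d"
    by (simp add: vec_eq_iff) (simp add: scaleR_conv_of_real)
  show ?thesis unfolding r by (rule commutantD[OF assms])
qed

lemma commutant_compose:
  fixes A :: "complex^'d^'d"
  assumes p: "p \<in> commutant S" and A: "\<And>B w. B \<in> S \<Longrightarrow> A *v (B *v w) = B *v (A *v w)"
  shows "(\<lambda>w. A *v p w) \<in> commutant S" "(\<lambda>w. p (A *v w)) \<in> commutant S"
  by (rule commutantI; simp add: A[symmetric] commutantD[OF p]
      matrix_vector_right_distrib vector_scalar_commute)+

text \<open>
  If \<open>w = p v\<close> with \<open>p\<close> in the commutant of \<open>S\<close>, then \<open>A w = p A v = p A' v\<close>, and \<open>p A'\<close> is again in this
  commutant. If \<open>w = q v\<close> with \<open>q\<close> in the commutant of \<open>T\<close>, then so is \<open>A q\<close>. In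
  the application \<open>A\<close> is a combination of the \<open>X\<^sub>s\<close> and
  \<open>A'\<close> the combination of the \<open>Y\<^sub>t\<close> with the same effect on \<open>v\<close>, or the other way round.
\<close>

lemma commutant_orbits_invariant:
  fixes A A' :: "complex^'d^'d"
  assumes "A \<in> S" and eq: "A *v v = A' *v v"
    and S: "\<And>B w. B \<in> S \<Longrightarrow> A' *v (B *v w) = B *v (A' *v w)"
    and T: "\<And>B w. B \<in> T \<Longrightarrow> A *v (B *v w) = B *v (A *v w)"
    and w: "w \<in> commutant_orbit S v" "w \<in> commutant_orbit T v"
  shows "A *v w \<in> commutant_orbit S v" "A *v w \<in> commutant_orbit T v"
proof -
  obtain p where p: "p \<in> commutant S" "w = p v" using w(1) by (rule commutant_orbitE)
  have "A *v w = p (A' *v v)"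
    using commutantD(3)[OF p(1) \<open>A \<in> S\<close>] by (simp add: p(2) eq)
  moreover have "(\<lambda>w. p (A' *v w)) \<in> commutant S"
    by (rule commutant_compose(2)[OF p(1)]) (rule S)
  ultimately show "A *v w \<in> commutant_orbit S v" by (intro commutant_orbitI)
  obtain q where q: "q \<in> commutant T" "w = q v" using w(2) by (rule commutant_orbitE)
  have "(\<lambda>w. A *v q w) \<in> commutant T"
    by (rule commutant_compose(1)[OF q(1)]) (rule T)
  then show "A *v w \<in> commutant_orbit T v" by (rule commutant_orbitI) (simp add: q(2))
qed

text \<open>
  A relation that holds at \<open>v\<close> holds at \<open>p v\<close>, since \<open>p\<close> moves past both matrices.
\<close>

lemma anticommutator_on_commutant_orbit:
  assumes "A \<in> S" "B \<in> S" and v: "A *v (B *v v) + B *v (A *v v) = r *\<^sub>R v"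
    and w: "w \<in> commutant_orbit S v"
  shows "A *v (B *v w) + B *v (A *v w) = r *\<^sub>R w"
proof -
  obtain p where p: "p \<in> commutant S" "w = p v" using w by (rule commutant_orbitE)
  have "A *v (B *v w) + B *v (A *v w) = p (A *v (B *v v) + B *v (A *v v))"
    using assms(1,2) by (simp add: p(2) commutantD[OF p(1)])
  then show ?thesis by (simp only: v commutant_scaleR[OF p(1)] p(2))
qed

section \<open>Clifford relations from extremality\<close>

text \<open>
  On a basis selected among the \<open>x\<^sub>s\<close> the lift sends \<open>x\<^sub>s\<close> to \<open>f\<^sub>s\<close>. It serves to turn vectors \<open>X\<^sub>s v\<close>
  back into combinations of the operators \<open>X\<^sub>s\<close>, linearly in the vector, so that the operators can be
  inserted into a bilinear form.
\<close>

lemma linear_lift_on_span: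
  fixes x :: "'s \<Rightarrow> 'a::real_vector" and f :: "'s \<Rightarrow> 'b::real_vector"
  assumes lin: "linear \<phi>" and f: "\<And>s. \<phi> (f s) = x s"
  obtains g where "linear g" "\<And>u. g u \<in> span (range f)"
    "\<And>u. u \<in> span (range x) \<Longrightarrow> \<phi> (g u) = u"
proof -
  obtain B where B: "B \<subseteq> range x" "independent B" "range x \<subseteq> span B"
    using maximal_independent_subset[of "range x"] by blast
  define idx where "idx = (\<lambda>b. SOME s. x s = b)"
  have idx: "x (idx b) = b" if "b \<in> B" for b
    unfolding idx_def by (rule someI_ex) (use B(1) that in auto)
  obtain g where g: "linear g" "\<And>b. b \<in> B \<Longrightarrow> g b = f (idx b)"
    and rng: "range g = span ((\<lambda>b. f (idx b)) ` B)"
    using linear_independent_extend_subspace[OF B(2), of "\<lambda>b. f (idx b)"] by blast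
  have "span ((\<lambda>b. f (idx b)) ` B) \<subseteq> span (range f)"
    by (intro span_mono) auto
  then have "g u \<in> span (range f)" for u using rng by auto
  moreover have "\<phi> (g u) = u" if "u \<in> span (range x)" for u
  proof -
    have "u \<in> span B" using that B(3) by (metis span_minimal subspace_span subsetD)
    then show ?thesis
      using linear_eq_on[of "\<phi> \<circ> g" "\<lambda>u. u" u B] linear_compose[OF g(1) lin]
      by (simp add: g(2) f idx linear_ident)
  qed
  ultimately show ?thesis using g(1) that by blast
qed

lemma commute_span:
  fixes X :: "'m \<Rightarrow> complex^'d^'d" and Y :: "'n \<Rightarrow> complex^'d^'d"
  assumes com: "\<And>s t. X s ** Y t = Y t ** X s"
    and A: "A \<in> span (range X)" and B: "B \<in> span (range Y)"
  shows "A *v (B *v u) = B *v (A *v u)"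
proof -
  have sub: "subspace {A. \<forall>u. A *v (B *v u) = B *v (A *v u)}" for B :: "complex^'d^'d"
    by (auto simp: subspace_def matrix_vector_mult_add_rdistrib matrix_vector_right_distrib
        matrix_vector_scaleR)
  have "A *v (Y t *v u) = Y t *v (A *v u)" for t u
  proof -
    have "span (range X) \<subseteq> {A. \<forall>u. A *v (Y t *v u) = Y t *v (A *v u)}"
      by (rule span_minimal[OF _ sub]) (auto simp: matrix_vector_mul_assoc com)
    then show ?thesis using A by blast
  qed
  then have "span (range Y) \<subseteq> {B. \<forall>u. B *v (A *v u) = A *v (B *v u)}"
    by (intro span_minimal[OF _ sub]) auto
  then show ?thesis using B by auto
qed

text \<open>
  Equality case of the contraction property:
  \<open>\<parallel>A\<^sup>2 v - v\<parallel>\<^sup>2 = \<parallel>A\<^sup>2 v\<parallel>\<^sup>2 - 2 \<parallel>A v\<parallel>\<^sup>2 + \<parallel>v\<parallel>\<^sup>2 \<le> 1 - 2 + 1\<close>.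
\<close>

lemma self_adjoint_contraction_involutive:
  fixes A :: "complex^'d^'d"
  assumes "hermitian A" "\<And>u. norm (A *v u) \<le> norm u" "norm v = 1" "norm (A *v v) = 1"
  shows "A *v (A *v v) = v"
proof -
  have "(A *v (A *v v)) \<bullet> v = (norm (A *v v))\<^sup>2"
    by (simp add: hermitian_self_adjoint[OF assms(1), of "A *v v"] power2_norm_eq_inner)
  then have "(norm (A *v (A *v v) - v))\<^sup>2 = (norm (A *v (A *v v)))\<^sup>2 - 2 * (norm (A *v v))\<^sup>2 + (norm v)\<^sup>2"
    using inner_commute[of v "A *v (A *v v)"]
    by (simp add: power2_norm_eq_inner inner_diff_left inner_diff_right)
  also have "\<dots> \<le> 0"
    using power_mono[OF assms(2)[of "A *v v"], of 2] by (simp add: assms(3,4))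
  finally show ?thesis by simp
qed

text \<open>
  The heart of the argument. The rigidity of the \<open>x\<^sub>s\<close> and \<open>y\<^sub>t\<close>, applied to each scalar component
  of the vector-valued form \<open>g u g w v + g w g u v - 2 \<langle>u, w\<rangle> v\<close>, turns the fact that the \<open>X\<^sub>s\<close> and
  \<open>Y\<^sub>t\<close> square to the identity at \<open>v\<close> into the full Clifford relations at \<open>v\<close>.
\<close>

lemma extreme_Clifford_lifts:
  fixes C :: "real^'n^'m" and v :: "complex^'d"
  assumes ext: "C extreme_point_of Cor"
    and hX: "\<And>s. hermitian (X s)" and cX: "\<And>s u. norm (X s *v u) \<le> norm u"
    and hY: "\<And>t. hermitian (Y t)" and cY: "\<And>t u. norm (Y t *v u) \<le> norm u"
    and com: "\<And>s t. X s ** Y t = Y t ** X s"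
    and v: "norm v = 1" and C: "\<And>s t. C $ s $ t = (X s *v v) \<bullet> (Y t *v v)"
  obtains g h :: "complex^'d \<Rightarrow> complex^'d^'d" where
    "\<And>u. g u \<in> span (range X)" "\<And>u. h u \<in> span (range Y)"
    "\<And>u. u \<in> span (range (\<lambda>s. X s *v v)) \<Longrightarrow> g u *v v = u"
    "\<And>u. u \<in> span (range (\<lambda>s. X s *v v)) \<Longrightarrow> h u *v v = u"
    "\<And>u w. u \<in> span (range (\<lambda>s. X s *v v)) \<Longrightarrow> w \<in> span (range (\<lambda>s. X s *v v)) \<Longrightarrow>
      g u *v (g w *v v) + g w *v (g u *v v) = (2 * (u \<bullet> w)) *\<^sub>R v"
proof -
  define x where "x s = X s *v v" for s
  define y where "y t = Y t *v v" for t
  have nx: "norm (x s) \<le> 1" and ny: "norm (y t) \<le> 1" for s t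
    using cX[of s v] cY[of t v] v by (simp_all add: x_def y_def)
  have Cxy: "C $ s $ t = x s \<bullet> y t" for s t by (simp add: C x_def y_def)
  note extT = extreme_point_Cor_transpose[OF ext]
  have Cyx: "transpose C $ t $ s = y t \<bullet> x s" for s t
    by (simp add: transpose_def Cxy inner_commute)
  have ux: "norm (x s) = 1" and uy: "norm (y t) = 1" for s t
    using extreme_unit[where x = x and y = y, OF ext nx ny Cxy]
      extreme_unit[where x = y and y = x, OF extT ny nx Cyx] by auto
  have "x s \<in> span (range y)" "y t \<in> span (range x)" for s t
    using extreme_span[where x = x and y = y, OF ext nx ny Cxy]
      extreme_span[where x = y and y = x, OF extT ny nx Cyx] by auto
  then have H: "span (range x) = span (range y)"
    by (metis (no_types, lifting) image_subsetI span_minimal subspace_span subset_antisym)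
  have XX: "X s *v (X s *v v) = v" for s
    using self_adjoint_contraction_involutive[of "X s", OF hX cX v] ux by (simp add: x_def)
  have YY: "Y t *v (Y t *v v) = v" for t
    using self_adjoint_contraction_involutive[of "Y t", OF hY cY v] uy by (simp add: y_def)
  have lin: "linear (\<lambda>A :: complex^'d^'d. A *v v)"
    by (rule linearI) (simp_all add: matrix_vector_mult_add_rdistrib matrix_vector_scaleR)
  obtain g where g: "linear g" "\<And>u. g u \<in> span (range X)" "\<And>u. u \<in> span (range x) \<Longrightarrow> g u *v v = u"
    using linear_lift_on_span[OF lin, of X x] by (auto simp: x_def)
  obtain h where h: "linear h" "\<And>u. h u \<in> span (range Y)" "\<And>u. u \<in> span (range x) \<Longrightarrow> h u *v v = u"
    using linear_lift_on_span[OF lin, of Y y] by (auto simp: y_def H)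
  note cs = commute_span[where X = X and Y = Y, OF com]
  have inx: "x s \<in> span (range x)" and iny: "y t \<in> span (range x)" for s t
    unfolding H by (simp_all add: span_base H[symmetric]) (simp add: H span_base)
  \<comment> \<open>The matrix \<open>g (x s)\<close> may differ from \<open>X s\<close>, but both act alike on \<open>h (x s) *v v\<close>:
    they commute past \<open>h (x s)\<close>.\<close>
  have gx: "g (x s) *v (g (x s) *v v) = v" for s
  proof -
    have "g (x s) *v (g (x s) *v v) = g (x s) *v (h (x s) *v v)"
      by (simp add: g(3) h(3) inx)
    also have "\<dots> = h (x s) *v (X s *v v)"
      by (simp add: cs[OF g(2) h(2)] g(3) inx) (simp add: x_def)
    also have "\<dots> = X s *v (h (x s) *v v)"
      by (rule cs[OF _ h(2), symmetric]) (simp add: span_base)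
    also have "\<dots> = v" by (simp add: h(3) inx) (simp add: x_def XX)
    finally show ?thesis .
  qed
  have gy: "g (y t) *v (g (y t) *v v) = v" for t
  proof -
    have "g (y t) *v (g (y t) *v v) = g (y t) *v (Y t *v v)"
      by (simp add: g(3) iny) (simp add: y_def)
    also have "\<dots> = Y t *v (g (y t) *v v)"
      by (rule cs[OF g(2)]) (simp add: span_base)
    also have "\<dots> = v" by (simp add: g(3) iny) (simp add: y_def YY)
    finally show ?thesis .
  qed
  have "g u *v (g w *v v) + g w *v (g u *v v) = (2 * (u \<bullet> w)) *\<^sub>R v"
    if u: "u \<in> span (range x)" and w: "w \<in> span (range x)" for u w
  proof (rule vector_eq_ldot[THEN iffD1], rule allI)
    fix z
    \<comment> \<open>The component in direction \<open>z\<close> of the form that is to vanish.\<close>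
    define B where "B u w = z \<bullet> (g u *v (g w *v v)) + z \<bullet> (g w *v (g u *v v)) - 2 * (u \<bullet> w) * (z \<bullet> v)" for u w
    have bil: "bilinear B"
      unfolding bilinear_def
      by (intro conjI allI linearI)
        (simp_all add: B_def linear_add[OF g(1)] linear_cmul[OF g(1)] matrix_vector_mult_add_rdistrib
          matrix_vector_right_distrib matrix_vector_scaleR inner_add_left inner_add_right algebra_simps)
    have "B (x s) (y t) = 0" for s t
      by (rule extreme_form_zero[where x = x and y = y, OF ext nx ny Cxy bil])
        (simp_all add: B_def inner_commute gx gy ux uy flip: power2_norm_eq_inner)
    then have "B u w = 0"
      using bilinear_eq[OF bil, of "\<lambda>_ _. 0" "span (range x)" "range x" "span (range y)" "range y" u w] u w H
      by (auto simp: bilinear_def linear_zero)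
    then show "z \<bullet> (g u *v (g w *v v) + g w *v (g u *v v)) = z \<bullet> ((2 * (u \<bullet> w)) *\<^sub>R v)"
      by (simp add: B_def inner_add_right)
  qed
  then show ?thesis
    using that[of g h] g(2,3) h(2,3) by (simp add: x_def)
qed

section \<open>The dimension bound\<close>

lemma rank_inner_le:
  fixes C :: "real^'n^'m" and x :: "'m \<Rightarrow> 'a::euclidean_space"
  assumes C: "\<And>s t. C $ s $ t = x s \<bullet> y t"
  shows "rank C \<le> dim (span (range x))"
proof -
  define L where "L u = (\<chi> t. u \<bullet> y t)" for u
  have "linear L"
    by (rule linearI) (simp_all add: L_def vec_eq_iff inner_add_left)
  moreover have "rows C = L ` range x"
    by (auto simp: rows_def row_def L_def C vec_eq_iff image_image)
  ultimately show ?thesis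
    by (simp add: row_rank_def dim_image_le)
qed

theorem theorem4p4:
  fixes C :: "real^'n^'m"
    and W :: "complex^'d^'d"
    and X :: "'m \<Rightarrow> complex^'d^'d"
    and Y :: "'n \<Rightarrow> complex^'d^'d"
  assumes "C extreme_point_of Cor"
    and "commuting_operator_rep C W X Y"
  shows "CARD('d) \<ge> (2 ^ (rank C div 2))\<^sup>2"
proof -
  have hX: "\<And>s. hermitian (X s)" and hY: "\<And>t. hermitian (Y t)"
    and com: "\<And>s t. X s ** Y t = Y t ** X s"
    and cX: "\<And>s u. norm (X s *v u) \<le> norm u" and cY: "\<And>t u. norm (Y t *v u) \<le> norm u"
    using assms(2) by (auto simp: commuting_operator_rep_def intro: hermitian_contraction)
  obtain v where v: "norm v = 1" and C: "\<And>s t. C $ s $ t = (X s *v v) \<bullet> (Y t *v v)"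
    using extreme_rep_pure_state[OF assms] by blast
  define H where "H = span (range (\<lambda>s. X s *v v))"
  obtain g h where gX: "\<And>u. g u \<in> span (range X)" and hY': "\<And>u. h u \<in> span (range Y)"
    and gv: "\<And>u. u \<in> H \<Longrightarrow> g u *v v = u" and hv: "\<And>u. u \<in> H \<Longrightarrow> h u *v v = u"
    and gg: "\<And>u w. u \<in> H \<Longrightarrow> w \<in> H \<Longrightarrow> g u *v (g w *v v) + g w *v (g u *v v) = (2 * (u \<bullet> w)) *\<^sub>R v"
    by (rule extreme_Clifford_lifts[where X = X and Y = Y, OF assms(1) hX cX hY cY com v C, folded H_def])
      (rule that)
  note gh = commute_span[where X = X and Y = Y, OF com gX hY']
  \<comment> \<open>The products of the \<open>h\<close> at \<open>v\<close> are those of the \<open>g\<close> in reverse order,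
    so they satisfy the same relations.\<close>
  have hh: "h u *v (h w *v v) + h w *v (h u *v v) = (2 * (u \<bullet> w)) *\<^sub>R v"
    if "u \<in> H" "w \<in> H" for u w
  proof -
    have "h u *v (h w *v v) = g w *v (g u *v v)" if "u \<in> H" "w \<in> H" for u w
      using that gh[of w u v] by (simp add: gv hv)
    then show ?thesis using gg[of u w] that by (simp add: add.commute)
  qed

  define V where "V = commutant_orbit (span (range X)) v \<inter> commutant_orbit (span (range Y)) v"
  have sub: "vec.subspace V"
    unfolding V_def by (intro vec.subspace_inter subspace_commutant_orbit)
  have "v \<in> V"
    unfolding V_def by (intro IntI commutant_orbitI[of "\<lambda>u. u"] commutantI) simp_all
  then have nz: "V \<noteq> {0}" using v by auto
  have gS: "g u *v (A *v w) = A *v (g u *v w)" if "A \<in> span (range Y)" for A u w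
    by (rule commute_span[where X = X and Y = Y, OF com gX that])
  have hS: "h u *v (A *v w) = A *v (h u *v w)" if "A \<in> span (range X)" for A u w
    by (rule commute_span[where X = X and Y = Y, OF com that hY', symmetric])
  have invg: "g u *v w \<in> V" if u: "u \<in> H" and w: "w \<in> V" for u w
    using commutant_orbits_invariant[OF gX, of u v "h u" "span (range Y)" w] gS hS w
    by (simp add: V_def gv[OF u] hv[OF u])
  have invh: "h u *v w \<in> V" if u: "u \<in> H" and w: "w \<in> V" for u w
    using commutant_orbits_invariant[OF hY', of u v "g u" "span (range X)" w] gS hS w
    by (simp add: V_def gv[OF u] hv[OF u])
  define G where "G b u = (if b then g u else h u)" for b u
  have GG: "G b u *v (G b w *v z) + G b w *v (G b u *v z) = (2 * (u \<bullet> w)) *\<^sub>R z"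
    if "u \<in> H" "w \<in> H" "z \<in> V" for b u w z
    using that(3) anticommutator_on_commutant_orbit[OF gX gX gg[OF that(1,2)]]
      anticommutator_on_commutant_orbit[OF hY' hY' hh[OF that(1,2)]]
    by (simp add: G_def V_def)

  have "subspace H" by (simp add: H_def)
  then obtain B where B: "B \<subseteq> H" "pairwise orthogonal B" "\<And>b. b \<in> B \<Longrightarrow> norm b = 1"
    and indep: "independent B" and card: "card B = dim H" and "span B = H"
    by (rule orthonormal_basis_subspace) (rule that)
  define k where "k = rank C div 2"
  have "rank C \<le> card B" unfolding card H_def by (rule rank_inner_le[where y = "\<lambda>t. Y t *v v"]) (rule C)
  then have "2 * k \<le> card B" by (simp add: k_def)
  then obtain e where inj: "inj_on e {..<2 * k}" and eB: "e ` {..<2 * k} \<subseteq> B"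
    using card_le_inj[of "{..<2 * k}" B] independent_imp_finite[OF indep] by auto
  have eH: "e i \<in> H" and e1: "e i \<bullet> e i = 1" if "i < 2 * k" for i
    using eB B that by (auto simp: power2_norm_eq_inner[symmetric])
  have e0: "e i \<bullet> e j = 0" if "i < 2 * k" "j < 2 * k" "i \<noteq> j" for i j
  proof -
    have "e i \<noteq> e j" using inj that by (auto simp: inj_on_def)
    then show ?thesis using B(2) eB that by (auto simp: pairwise_def orthogonal_def)
  qed
  have "(2 ^ k)\<^sup>2 \<le> vec.dim V"
  proof (rule commuting_Clifford_families_dim[OF sub nz, of k "\<lambda>b i. G b (e i)"])
    fix b i u assume i: "i < 2 * k" and u: "u \<in> V"
    show "G b (e i) *v u \<in> V" using invg invh eH[OF i] u by (simp add: G_def)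
    have "2 *\<^sub>R (G b (e i) *v (G b (e i) *v u)) = 2 *\<^sub>R u"
      using GG[OF eH[OF i] eH[OF i] u, of b] by (simp add: e1[OF i] scaleR_2)
    then show "G b (e i) *v (G b (e i) *v u) = u" by simp
    fix j assume j: "j < 2 * k"
    show "G b (e i) *v (G b (e j) *v u) = - (G b (e j) *v (G b (e i) *v u))" if "i \<noteq> j"
      using GG[OF eH[OF i] eH[OF j] u, of b] e0[OF i j that] by (simp add: eq_neg_iff_add_eq_0)
    show "G b (e i) *v (G c (e j) *v u) = G c (e j) *v (G b (e i) *v u)" if "b \<noteq> c" for c
      using gh that by (auto simp: G_def)
  qed
  also have "\<dots> \<le> CARD('d)" by (rule dim_subset_UNIV_cart_gen)
  finally show ?thesis by (simp add: k_def)
qed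

end
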